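(* Let $\alpha\in(1,2]$, $\sigma>0$, $u>0$, $S>0$, $0<K_-<K_+$, $r\in\mathbb{R}$, $\tau>0$, let $X_t\sim L(0,\sigma^\alpha,-1)$, and put $\mu=\sigma^\alpha/\cos\frac{\pi\alpha}{2}$ and $k_u^{\pm}:=\log\frac{S}{K_\pm^{1/u}}+r\tau$. The value of the capped power asset-or-nothing call option, i.e. the option with payoff $\mathcal{P}^{(A/N,cap)}(S_T,K_+,K_-)=S_T^u\,\mathbf{1}_{\{K_-<S_T^u<K_+\}}$, is $$C_\alpha^{(A/N,cap)}(S,K_+,K_-,r,\mu,\tau)=\frac{e^{-r\tau}}{\alpha}S^u e^{u(r+\mu)\tau}\sum_{n=0}^\infty\sum_{m=0}^\infty\frac{(-u)^m\left((k_u^-+\mu\tau)^{1+n+m}-(k_u^++\mu\tau)^{1+n+m}\right)}{(1+n+m)\,n!\,m!\,\Gamma\left(1-\frac{1+n}{\alpha}\right)}\,(-\mu\tau)^{-\frac{1+n}{\alpha}}.$$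
   Context: The process $X_t\sim L(0,\sigma^\alpha,-1)$ is the spectrally negative $\alpha$-stable Lévy process with characteristic function $\mathbb{E}[e^{ikX_t}]=\exp\left(-t\,\sigma^\alpha|k|^\alpha\left(1+i\tan\frac{\alpha\pi}{2}\,\mathrm{sgn}\,k\right)\right)$ for $k\in\mathbb{R}$; equivalently $\mathbb{E}[e^{pX_t}]=e^{-\mu t p^\alpha}$ for $p>0$, with $\mu=\sigma^\alpha/\cos\frac{\pi\alpha}{2}<0$. The asset price at maturity is $S_T=S\,e^{(r+\mu)\tau+X_\tau}$, where $\tau$ is the time-to-maturity, and the value of an option with payoff $\mathcal{P}(S_T,K_+,K_-)$ is $e^{-r\tau}\,\mathbb{E}\left[\mathcal{P}\left(Se^{(r+\mu)\tau+X_\tau},K_+,K_-\right)\right]$. Convention: $1/\Gamma(z)=0$ when $z$ is a non-positive integer. *)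

theory Defs
  imports "HOL-Probability.Probability"
begin

text \<open>A real-valued Levy process with time index \<open>t \<ge> 0\<close>. The family \<open>X\<close> is indexed by all reals
  for typing reasons only; nothing is assumed about negative times.\<close>

locale levy_process = prob_space M for M :: "'a measure" +
  fixes X :: "real \<Rightarrow> 'a \<Rightarrow> real"
  assumes random_variable_X: "0 \<le> t \<Longrightarrow> random_variable borel (X t)"
    and X_zero: "AE \<omega> in M. X 0 \<omega> = 0"
    and independent_increments:
      "0 \<le> T 0 \<Longrightarrow> mono_on {..n} T \<Longrightarrow>
        indep_vars (\<lambda>_. borel) (\<lambda>i \<omega>. X (T (Suc i)) \<omega> - X (T i) \<omega>) {..<n :: nat}"
    and stationary_increments:
      "0 \<le> s \<Longrightarrow> 0 \<le> t \<Longrightarrow>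
        distr M borel (\<lambda>\<omega>. X (s + t) \<omega> - X s \<omega>) = distr M borel (X t)"
    and stochastically_continuous:
      "0 \<le> t \<Longrightarrow> 0 < \<epsilon> \<Longrightarrow>
        ((\<lambda>s. prob {\<omega> \<in> space M. \<epsilon> \<le> \<bar>X s \<omega> - X t \<omega>\<bar>}) \<longlongrightarrow> 0) (at t within {0..})"

text \<open>The process \<open>L(0, \<sigma>\<^sup>\<alpha>, -1)\<close>: the skewness \<open>-1\<close> accounts for the plus sign in front of the
  tangent.\<close>

locale spectrally_negative_stable_process = levy_process M X
  for M :: "'a measure" and X :: "real \<Rightarrow> 'a \<Rightarrow> real" +
  fixes \<alpha> \<sigma> :: real
  assumes char_X: "0 \<le> t \<Longrightarrow>
    char (distr M borel (X t)) k =
      exp (- complex_of_real (t * \<sigma> powr \<alpha> * \<bar>k\<bar> powr \<alpha>) *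
        (1 + \<i> * complex_of_real (tan (\<alpha> * pi / 2) * sgn k)))"

definition asset_price ::
    "(real \<Rightarrow> 'a \<Rightarrow> real) \<Rightarrow> real \<Rightarrow> real \<Rightarrow> real \<Rightarrow> real \<Rightarrow> 'a \<Rightarrow> real"
  where "asset_price X S r \<mu> \<tau> \<omega> = S * exp ((r + \<mu>) * \<tau> + X \<tau> \<omega>)"

definition option_value ::
    "'a measure \<Rightarrow> (real \<Rightarrow> 'a \<Rightarrow> real) \<Rightarrow> (real \<Rightarrow> real \<Rightarrow> real \<Rightarrow> real) \<Rightarrow>
      real \<Rightarrow> real \<Rightarrow> real \<Rightarrow> real \<Rightarrow> real \<Rightarrow> real \<Rightarrow> real"
  where "option_value M X P S Kp Km r \<mu> \<tau> =
    exp (- r * \<tau>) * (\<integral>\<omega>. P (asset_price X S r \<mu> \<tau> \<omega>) Kp Km \<partial>M)"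

definition capped_power_asset_or_nothing_call :: "real \<Rightarrow> real \<Rightarrow> real \<Rightarrow> real \<Rightarrow> real"
  where "capped_power_asset_or_nothing_call u s Kp Km =
    s powr u * indicator {Km<..<Kp} (s powr u)"

end

theory Submission
  imports Defs "HOL-Real_Asymp.Real_Asymp"
begin

text \<open>
  The characteristic function of \<open>X\<^sub>\<tau>\<close> is \<open>exp (- w t\<^sup>\<alpha>)\<close> for \<open>t > 0\<close>, where
  \<open>w = - \<mu> \<tau> exp (\<i> (\<pi> \<alpha> / 2 - \<pi>))\<close> has positive real part. Since \<open>\<alpha> > 1\<close>, it decays faster than
  every exponential, so the kernel in Levy's inversion formula may be expanded in powers of \<open>t\<close> and
  integrated termwise. Hence \<open>X\<^sub>\<tau>\<close> has a density that is an entire power series, whose \<open>n\<close>-th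
  coefficient is the real part of \<open>(- \<i>)\<^sup>n / (\<pi> n!)\<close> times the moment
  \<open>\<integral> t\<^sup>n exp (- w t\<^sup>\<alpha>) dt\<close> over the half-line. That moment is
  \<open>\<Gamma>(s) / \<alpha> \<cdot> w powr (- s)\<close> with \<open>s = (n + 1) / \<alpha>\<close>; the reflection formula turns \<open>\<Gamma>(s) sin (\<pi> s)\<close> into
  \<open>\<pi> / \<Gamma>(1 - s)\<close>. After the reflection \<open>x = - y\<close>, the payoff is a multiple of \<open>exp (- u y)\<close> on the
  interval with end points \<open>k\<^sub>u\<^sup>\<plusminus> + \<mu> \<tau>\<close>, and termwise integration of the two power series gives
  the double series.
\<close>

section \<open>Moments of stretched exponentials\<close>

lemma exp_series_sums:
  fixes x :: "'a :: {real_normed_field, banach}"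
  shows "(\<lambda>n. x ^ n / fact n) sums exp x"
  using exp_converges[of x] by (simp add: scaleR_conv_of_real field_simps)

text \<open>Integrating the partial sums bounds them by the integral of \<open>F\<close>, so the
  \<open>L1\<close> norms are summable and sum and integral may be exchanged. All termwise
  integrations below rest on this.\<close>

lemma sums_integral_dominated:
  fixes f :: "nat \<Rightarrow> 'a \<Rightarrow> 'b :: {banach, second_countable_topology}"
  assumes f: "\<And>n. integrable M (f n)" and F: "integrable M F"
    and summable: "\<And>x. x \<in> space M \<Longrightarrow> summable (\<lambda>n. norm (f n x))"
    and le: "\<And>x. x \<in> space M \<Longrightarrow> (\<Sum>n. norm (f n x)) \<le> F x"
  shows "(\<lambda>n. \<integral>x. f n x \<partial>M) sums (\<integral>x. (\<Sum>n. f n x) \<partial>M)"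
    and "summable (\<lambda>n. \<integral>x. norm (f n x) \<partial>M)"
proof -
  show *: "summable (\<lambda>n. \<integral>x. norm (f n x) \<partial>M)"
  proof (rule summableI_nonneg_bounded)
    fix n
    have "(\<Sum>i<n. \<integral>x. norm (f i x) \<partial>M) = (\<integral>x. (\<Sum>i<n. norm (f i x)) \<partial>M)"
      using f by (subst Bochner_Integration.integral_sum) auto
    also have "\<dots> \<le> (\<integral>x. F x \<partial>M)"
      using f F
      by (intro integral_mono Bochner_Integration.integrable_sum order_trans[OF sum_le_suminf le] summable)
         auto
    finally show "(\<Sum>i<n. \<integral>x. norm (f i x) \<partial>M) \<le> (\<integral>x. F x \<partial>M)" .
  qed auto
  show "(\<lambda>n. \<integral>x. f n x \<partial>M) sums (\<integral>x. (\<Sum>n. f n x) \<partial>M)"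
    by (rule sums_integral[OF f _ *]) (use summable in auto)
qed

text \<open>The substitution \<open>t = c * x powr \<alpha>\<close> turns the integral into Euler's
  integral for \<open>Gamma (p / \<alpha>)\<close>.\<close>

lemma set_integral_powr_exp_powr:
  fixes \<alpha> c p :: real
  assumes "0 < \<alpha>" "0 < c" "0 < p"
  shows "set_integrable lborel {0<..} (\<lambda>x. x powr (p - 1) * exp (- c * x powr \<alpha>))"
    and "(LINT x:{0<..}|lborel. x powr (p - 1) * exp (- c * x powr \<alpha>)) =
      Gamma (p / \<alpha>) / \<alpha> * c powr (- (p / \<alpha>))"
proof -
  define s where "s = p / \<alpha>"
  have s: "0 < s" using assms by (simp add: s_def)
  let ?f = "\<lambda>x. x powr (p - 1) * exp (- c * x powr \<alpha>)"
  \<comment> \<open>\<open>?g\<close> inverts \<open>t = c * x powr \<alpha>\<close>, and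
    \<open>?g'\<close> is its derivative.\<close>
  let ?g = "\<lambda>t. (t / c) powr (1 / \<alpha>)"
  let ?g' = "\<lambda>t. (1 / \<alpha>) * (t / c) powr (1 / \<alpha> - 1) * (1 / c)"
  let ?h = "\<lambda>t. t powr (s - 1) / exp t"
  have eq: "?f (?g t) * ?g' t = c powr (- s) / \<alpha> * ?h t" if "0 < t" for t
  proof -
    have "?f (?g t) * ?g' t =
        ((t / c) powr ((p - 1) / \<alpha>) * (t / c) powr (1 / \<alpha> - 1)) * exp (- t) / (c * \<alpha>)"
      using that assms by (simp add: powr_powr field_simps)
    also have "(t / c) powr ((p - 1) / \<alpha>) * (t / c) powr (1 / \<alpha> - 1) = (t / c) powr (s - 1)"
      using assms by (simp add: powr_add[symmetric] s_def diff_divide_distrib)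
    also have "\<dots> = t powr (s - 1) * c powr (- s) * c"
      using that assms by (simp add: powr_divide powr_diff powr_minus field_simps)
    finally show ?thesis
      using assms by (simp add: field_simps exp_minus)
  qed
  have h_HK: "(?h has_integral Gamma s) {0<..}"
  proof -
    \<comment> \<open>Euler's integral is stated over \<open>{0..}\<close>. As
      \<open>0 powr (s - 1) = 0\<close>, the integrand vanishes at the extra point.\<close>
    have *: "{x \<in> {0..} - {0<..}. ?h x \<noteq> 0} = {}" "{x \<in> {0<..} - {0..}. ?h x \<noteq> 0} = {}"
      by auto
    show ?thesis
      using Gamma_integral_real[OF s]
      by (subst has_integral_spike_set_eq[where T = "{0..}"]) (simp_all only: * negligible_empty)
  qed
  \<comment> \<open>For a nonnegative function the gauge integral yields Lebesgue integrability with
    respect to the completed measure; Borel measurability brings this back to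
    \<open>lborel\<close>.\<close>
  then have "?h absolutely_integrable_on {0<..}"
    by (intro nonnegative_absolutely_integrable_1) auto
  then have h_int: "set_integrable lborel {0<..} ?h"
    unfolding set_integrable_def by (subst (asm) integrable_completion) auto
  have h: "(LINT x:{0<..}|lborel. ?h x) = Gamma s"
    using set_borel_integral_eq_integral(2)[OF h_int] integral_unique[OF h_HK] by (rule trans)
  have fg: "set_integrable lborel {0<..} (\<lambda>t. ?f (?g t) * ?g' t)"
    using set_integrable_mult_right[OF h_int, of "c powr (- s) / \<alpha>"]
    by (rule set_integrable_cong[THEN iffD1, rotated -1]) (use eq in auto)
  have A: "((ereal \<circ> ?g \<circ> real_of_ereal) \<longlongrightarrow> 0) (at_right 0)"
  proof -
    have "((\<lambda>t. ereal (?g t)) \<longlongrightarrow> ereal 0) (at_right 0)"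
      using assms by (intro tendsto_ereal) real_asymp
    then show ?thesis
      by (simp add: zero_ereal_def at_right_ereal filterlim_filtermap comp_def)
  qed
  have B: "((ereal \<circ> ?g \<circ> real_of_ereal) \<longlongrightarrow> \<infinity>) (at_left \<infinity>)"
  proof -
    have "filterlim ?g at_top at_top"
      using assms by real_asymp
    then show ?thesis
      by (simp add: at_left_PInf filterlim_filtermap comp_def tendsto_PInfty_eq_at_top)
  qed
  have pre: "(0::ereal) < \<infinity>"
    "\<And>x. 0 < ereal x \<Longrightarrow> DERIV ?g x :> ?g' x"
    "\<And>x. 0 < ereal x \<Longrightarrow> isCont ?f (?g x)"
    "\<And>x. 0 < ereal x \<Longrightarrow> isCont ?g' x"
    "\<And>x. 0 < ereal x \<Longrightarrow> 0 \<le> ?f (?g x)"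
    "\<And>x. 0 \<le> ereal x \<Longrightarrow> 0 \<le> ?g' x"
    using assms by (auto intro!: derivative_eq_intros continuous_intros)
  have ein: "einterval 0 \<infinity> = {0<..}"
    by (auto simp: einterval_def)
  have fg': "set_integrable lborel (einterval 0 \<infinity>) (\<lambda>t. ?f (?g t) * ?g' t)"
    using fg by (simp only: ein)
  note subst = interval_integral_substitution_nonneg[where f = ?f and g = ?g and g' = ?g',
      OF pre(1) pre(2) pre(3) pre(4) pre(5) pre(6) A B fg']
  show "set_integrable lborel {0<..} ?f"
    using subst(1) by (simp only: ein)
  have "(LINT x:{0<..}|lborel. ?f x) = (LINT t:{0<..}|lborel. ?f (?g t) * ?g' t)"
    using subst(2) by (simp only: interval_lebesgue_integral_def ein pre(1) less_imp_le if_True)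
  also have "\<dots> = (LINT t:{0<..}|lborel. c powr (- s) / \<alpha> * ?h t)"
    by (intro set_lebesgue_integral_cong) (use eq in auto)
  also have "\<dots> = Gamma s / \<alpha> * c powr (- s)"
    by (simp only: set_integral_mult_right h) simp
  finally show "(LINT x:{0<..}|lborel. ?f x) = Gamma (p / \<alpha>) / \<alpha> * c powr (- (p / \<alpha>))"
    by (simp add: s_def)
qed

lemma set_integral_powr_exp_complex_powr:
  fixes \<alpha> p :: real and w :: complex
  assumes \<alpha>: "0 < \<alpha>" and p: "0 < p" and w: "0 < Re w"
  shows "set_integrable lborel {0<..}
      (\<lambda>x. of_real (x powr (p - 1)) * exp (- w * of_real (x powr \<alpha>)))"
    and "(CLINT x:{0<..}|lborel. of_real (x powr (p - 1)) * exp (- w * of_real (x powr \<alpha>))) =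
      of_real (Gamma (p / \<alpha>) / \<alpha>) * w powr (- of_real (p / \<alpha>))"
proof -
  define s where "s = p / \<alpha>"
  have s: "0 < s" using assms by (simp add: s_def)
  \<comment> \<open>With this \<open>c\<close>, the distance from \<open>w\<close> to \<open>c\<close> is less than \<open>c\<close>, so \<open>exp (- (w - c) x\<^sup>\<alpha>)\<close> can be
    expanded without leaving the integrable range, and the resulting series of moments is
    binomial in \<open>z = w / c - 1\<close>, inside its disc of convergence. This replaces a contour rotation.\<close>
  define c where "c = (norm w)\<^sup>2 / Re w"
  have w0: "w \<noteq> 0" using w by auto
  have c: "0 < c" using w w0 by (simp add: c_def)
  define z where "z = (w - of_real c) / of_real c"
  have w_eq: "w = of_real c * (1 + z)"
    using c by (simp add: z_def field_simps)
  have dist: "norm (of_real c - w) < c"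
  proof (rule power2_less_imp_less)
    \<comment> \<open>Since \<open>c * Re w\<close> is the squared norm of \<open>w\<close>, the
      squared distance is the square of \<open>c\<close> minus the squared norm of
      \<open>w\<close>.\<close>
    have "(norm (of_real c - w))\<^sup>2 = (c - Re w)\<^sup>2 + (Im w)\<^sup>2"
      by (simp add: cmod_power2)
    also have "\<dots> = c\<^sup>2 + ((norm w)\<^sup>2 - 2 * (c * Re w))"
      unfolding cmod_power2[of w] by (simp add: power2_diff algebra_simps)
    also have "c * Re w = (norm w)\<^sup>2"
      using w by (simp add: c_def)
    also have "c\<^sup>2 + ((norm w)\<^sup>2 - 2 * (norm w)\<^sup>2) < c\<^sup>2"
      using w0 by simp
    finally show "(norm (of_real c - w))\<^sup>2 < c\<^sup>2" .
  qed (use c in simp)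
  have z: "norm z < 1"
    using dist c by (simp add: z_def norm_divide norm_minus_commute)
  let ?g = "\<lambda>x. of_real (x powr (p - 1)) * exp (- w * of_real (x powr \<alpha>)) :: complex"
  let ?h = "\<lambda>q x. x powr (q - 1) * exp (- c * x powr \<alpha>)"
  define f where "f j x = (of_real c - w) ^ j / fact j *
      of_real (indicator {0<..} x * ?h (p + real j * \<alpha>) x)" for j :: nat and x :: real
  \<comment> \<open>Taking norms in the expansion replaces \<open>c - w\<close> by \<open>d\<close>.
    The norms therefore sum to \<open>F\<close>, which is integrable because its rate
    \<open>c - d\<close> is still positive.\<close>
  define d where "d = norm (of_real c - w)"
  define F where "F x = indicator {0<..} x * (x powr (p - 1) * exp (- (c - d) * x powr \<alpha>))" for x :: real
  have h: "integrable lborel (\<lambda>x. indicator {0<..} x * ?h (p + real j * \<alpha>) x)"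
      "(LINT x|lborel. indicator {0<..} x * ?h (p + real j * \<alpha>) x) =
        Gamma (s + real j) / \<alpha> * c powr (- (s + real j))" for j :: nat
  proof -
    have pos: "0 < p + real j * \<alpha>" using assms by (intro add_pos_nonneg) auto
    have "(p + real j * \<alpha>) / \<alpha> = s + real j" using \<alpha> by (simp add: s_def field_simps)
    then show "integrable lborel (\<lambda>x. indicator {0<..} x * ?h (p + real j * \<alpha>) x)"
      "(LINT x|lborel. indicator {0<..} x * ?h (p + real j * \<alpha>) x) =
        Gamma (s + real j) / \<alpha> * c powr (- (s + real j))"
      using set_integral_powr_exp_powr[OF \<alpha> c pos]
      by (simp_all add: set_integrable_def set_lebesgue_integral_def)
  qed
  have f_int: "integrable lborel (f j)" for j
    unfolding f_def by (intro integrable_mult_right integrable_of_real h)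
  have f_integral: "(CLINT x|lborel. f j x) =
      of_real (Gamma s / \<alpha> * c powr (- s)) * ((- of_real s gchoose j) * z ^ j)" for j
  proof -
    have "(CLINT x|lborel. f j x) =
        (of_real c - w) ^ j / fact j * of_real (Gamma (s + real j) / \<alpha> * c powr (- (s + real j)))"
      unfolding f_def by (simp only: integral_mult_right_zero integral_complex_of_real h)
    \<comment> \<open>The quotient \<open>Gamma (s + j) / Gamma s\<close> is a rising factorial;
      with the sign and \<open>fact j\<close> it becomes the binomial coefficient of exponent
      \<open>- s\<close>.\<close>
    also have "Gamma (s + real j) = pochhammer s j * Gamma s"
      using s by (subst pochhammer_Gamma) (auto elim!: nonpos_Ints_cases simp: Gamma_eq_zero_iff)
    also have "c powr (- (s + real j)) = c powr (- s) / c ^ j"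
      using c by (simp add: powr_diff powr_realpow powr_minus field_simps)
    also have "(of_real c - w) ^ j = (- 1) ^ j * of_real c ^ j * z ^ j"
      using c by (simp add: z_def power_mult_distrib[symmetric])
    also have "(- 1) ^ j * of_real c ^ j * z ^ j / fact j *
        of_real (pochhammer s j * Gamma s / \<alpha> * (c powr (- s) / c ^ j)) =
        of_real (Gamma s / \<alpha> * c powr (- s)) * ((- of_real s gchoose j) * z ^ j)"
      using c \<alpha> by (simp add: gbinomial_pochhammer pochhammer_of_real field_simps)
    finally show ?thesis .
  qed
  have f_eq: "f j x = of_real (indicator {0<..} x * ?h p x) *
      (((of_real c - w) * of_real (x powr \<alpha>)) ^ j / fact j)" for j x
  proof (cases "0 < x")
    case True
    have "x powr (p + real j * \<alpha> - 1) = x powr (p - 1) * (x powr \<alpha>) ^ j"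
      using True by (simp add: powr_add[symmetric] powr_powr powr_realpow[symmetric] algebra_simps)
    then show ?thesis
      using True by (simp add: f_def power_mult_distrib)
  qed (simp add: f_def)
  have f_sums: "(\<lambda>j. f j x) sums (indicator {0<..} x *\<^sub>R ?g x)" for x
  proof -
    have "(\<lambda>j. f j x) sums (of_real (indicator {0<..} x * ?h p x) * exp ((of_real c - w) * of_real (x powr \<alpha>)))"
      unfolding f_eq by (intro sums_mult exp_series_sums)
    also have "of_real (indicator {0<..} x * ?h p x) * exp ((of_real c - w) * of_real (x powr \<alpha>)) =
        indicator {0<..} x *\<^sub>R ?g x"
      by (simp add: scaleR_conv_of_real exp_of_real[symmetric] exp_add[symmetric] algebra_simps exp_diff
          exp_minus divide_inverse split: split_indicator)
    finally show ?thesis .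
  qed
  have norm_sums: "(\<lambda>j. norm (f j x)) sums F x" for x
  proof -
    have "(\<lambda>j. indicator {0<..} x * ?h p x * ((d * x powr \<alpha>) ^ j / fact j)) sums
        (indicator {0<..} x * ?h p x * exp (d * x powr \<alpha>))"
      by (intro sums_mult exp_series_sums)
    also have "(\<lambda>j. indicator {0<..} x * ?h p x * ((d * x powr \<alpha>) ^ j / fact j)) = (\<lambda>j. norm (f j x))"
      unfolding f_eq d_def
      by (simp add: norm_mult norm_divide norm_power abs_mult fun_eq_iff)
    also have "indicator {0<..} x * ?h p x * exp (d * x powr \<alpha>) = F x"
      by (simp add: F_def exp_add[symmetric] algebra_simps)
    finally show ?thesis .
  qed
  have F: "integrable lborel F"
    using set_integral_powr_exp_powr(1)[OF \<alpha> _ p, of "c - d"] dist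
    unfolding F_def d_def set_integrable_def by simp
  have norm_F: "summable (\<lambda>j. norm (f j x))" "(\<Sum>j. norm (f j x)) \<le> F x" for x
    using norm_sums[of x] by (simp_all add: sums_iff)
  note main = sums_integral_dominated[where f = f and F = F and M = lborel, OF f_int F norm_F]
  show "set_integrable lborel {0<..} ?g"
  proof -
    have "integrable lborel (\<lambda>x. \<Sum>j. f j x)"
      by (rule integrable_suminf[OF f_int _ main(2)]) (use norm_F in auto)
    then show ?thesis
      using f_sums by (simp add: set_integrable_def sums_iff)
  qed
  have "(\<lambda>j. CLINT x|lborel. f j x) sums (CLINT x:{0<..}|lborel. ?g x)"
    using main(1) f_sums by (simp add: set_lebesgue_integral_def sums_iff)
  moreover have "(\<lambda>j. CLINT x|lborel. f j x) sums
      (of_real (Gamma s / \<alpha> * c powr (- s)) * (1 + z) powr (- of_real s))"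
    unfolding f_integral by (intro sums_mult gen_binomial_complex z)
  ultimately have "(CLINT x:{0<..}|lborel. ?g x) =
      of_real (Gamma s / \<alpha> * c powr (- s)) * (1 + z) powr (- of_real s)"
    by (rule sums_unique2)
  \<comment> \<open>The principal power of \<open>c * (1 + z)\<close> splits because
    \<open>c\<close> is a positive real.\<close>
  also have "\<dots> = of_real (Gamma s / \<alpha>) * w powr (- of_real s)"
    using c by (simp add: w_eq powr_times_real_left powr_of_real[symmetric])
  finally show "(CLINT x:{0<..}|lborel. ?g x) =
      of_real (Gamma (p / \<alpha>) / \<alpha>) * w powr (- of_real (p / \<alpha>))"
    by (simp add: s_def)
qed

section \<open>Levy inversion for rapidly decaying characteristic functions\<close>

text \<open>The constant terms of the two exponential series cancel, so every remaining term is
  divisible by \<open>- \<i> * t\<close>.\<close>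

lemma iexp_diff_quotient_sums:
  fixes a b t :: real
  assumes "t \<noteq> 0"
  shows "(\<lambda>n. of_real ((b ^ Suc n - a ^ Suc n) / real (Suc n)) * ((- \<i> * t) ^ n / fact n)) sums
    ((iexp (-(t * a)) - iexp (-(t * b))) / (\<i> * t))"
proof -
  have "(\<lambda>n. ((- \<i> * t * b) ^ n - (- \<i> * t * a) ^ n) / fact n) sums (exp (- \<i> * t * b) - exp (- \<i> * t * a))"
    using sums_diff[OF exp_converges[of "- \<i> * t * b"] exp_converges[of "- \<i> * t * a"]]
    by (simp add: scaleR_conv_of_real field_simps)
  then have "(\<lambda>n. ((- \<i> * t * b) ^ Suc n - (- \<i> * t * a) ^ Suc n) / fact (Suc n)) sums
      (exp (- \<i> * t * b) - exp (- \<i> * t * a))"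
    by (subst sums_Suc_iff) simp
  then have "(\<lambda>n. ((- \<i> * t * b) ^ Suc n - (- \<i> * t * a) ^ Suc n) / fact (Suc n) / (- \<i> * t)) sums
      ((exp (- \<i> * t * b) - exp (- \<i> * t * a)) / (- \<i> * t))"
    by (rule sums_divide)
  moreover have "((- \<i> * t * b) ^ Suc n - (- \<i> * t * a) ^ Suc n) / fact (Suc n) / (- \<i> * t) =
      of_real ((b ^ Suc n - a ^ Suc n) / real (Suc n)) * ((- \<i> * t) ^ n / fact n)" for n
  proof -
    have "(- \<i> * t * b) ^ Suc n - (- \<i> * t * a) ^ Suc n =
        (- \<i> * t) * ((- \<i> * t) ^ n * of_real (b ^ Suc n - a ^ Suc n))"
      unfolding power_mult_distrib by (simp add: algebra_simps)
    then show ?thesis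
      using assms by (simp add: fact_Suc)
  qed
  moreover have "(exp (- \<i> * t * b) - exp (- \<i> * t * a)) / (- \<i> * t) =
      (iexp (-(t * a)) - iexp (-(t * b))) / (\<i> * t)"
  proof -
    have swap: "(x - y) / (- z) = (y - x) / z" for x y z :: complex
      using minus_divide_divide[of "y - x" z] by (simp only: minus_diff_eq)
    show ?thesis
      using swap[of "exp (- \<i> * t * b)" "exp (- \<i> * t * a)" "\<i> * t"]
      by (simp only: mult.assoc mult_minus_left mult_minus_right of_real_mult of_real_minus)
  qed
  ultimately show ?thesis by simp
qed

context real_distribution
begin

text \<open>Levy's theorem gives a limit of integrals over \<open>(- n, n)\<close>. When the kernel
  is integrable, dominated convergence identifies the limit with the integral over the line.\<close>

lemma Levy_Inversion_integrable_char:
  fixes a b :: real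
  assumes "a \<le> b" "measure M {a} = 0" "measure M {b} = 0"
    and int: "integrable lborel (\<lambda>t::real. (iexp (-(t * a)) - iexp (-(t * b))) / (\<i> * t) * char M t)"
  shows "of_real (measure M {a<..b}) = 1 / (2 * pi) * (CLBINT t. (iexp (-(t * a)) - iexp (-(t * b))) / (\<i> * t) * char M t)"
proof -
  let ?f = "\<lambda>t::real. (iexp (-(t * a)) - iexp (-(t * b))) / (\<i> * t) * char M t"
  have "(\<lambda>n. CLBINT t=-real n..real n. ?f t) \<longlonglongrightarrow> (CLBINT t. ?f t)"
  proof -
    have "(\<lambda>n. CLBINT t. indicator {- real n<..<real n} t *\<^sub>R ?f t) \<longlonglongrightarrow> (CLBINT t. ?f t)"
    proof (rule integral_dominated_convergence[where w = "\<lambda>t. norm (?f t)"])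
      show "AE t in lborel. (\<lambda>n. indicator {- real n<..<real n} t *\<^sub>R ?f t) \<longlonglongrightarrow> ?f t"
      proof (intro AE_I2 tendsto_eventually)
        fix t :: real
        obtain N where "\<bar>t\<bar> < real N" using reals_Archimedean2 by blast
        then have "t \<in> {- real n<..<real n}" if "N \<le> n" for n
          using that by auto
        then show "\<forall>\<^sub>F n in sequentially. indicator {- real n<..<real n} t *\<^sub>R ?f t = ?f t"
          by (intro eventually_sequentiallyI[of N]) simp
      qed
      show "AE t in lborel. norm (indicator {- real n<..<real n} t *\<^sub>R ?f t) \<le> norm (?f t)" for n
        by (auto split: split_indicator)
      show "(\<lambda>t. indicator {- real n<..<real n} t *\<^sub>R ?f t) \<in> borel_measurable lborel" for n
        using int by (intro borel_measurable_scaleR) auto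
    qed (use int in auto)
    then show ?thesis
      by (simp add: interval_lebesgue_integral_def set_lebesgue_integral_def)
  qed
  then have "(\<lambda>n. 1 / (2 * pi) * (CLBINT t=-real n..real n. ?f t)) \<longlonglongrightarrow> 1 / (2 * pi) * (CLBINT t. ?f t)"
    by (intro tendsto_intros)
  with Levy_Inversion[OF assms(1-3)] show ?thesis
    by (simp only: of_int_minus of_int_of_nat_eq) (rule LIMSEQ_unique)
qed

lemma density_of_cdf_derivative:
  assumes eq: "\<And>a b. a \<le> b \<Longrightarrow> measure M {a} = 0 \<Longrightarrow> measure M {b} = 0 \<Longrightarrow>
      measure M {a<..b} = H b - H a"
    and H: "\<And>x. (H has_real_derivative h x) (at x)"
    and h: "continuous_on UNIV h"
  shows "M = density lborel (\<lambda>x. ennreal (h x))" and "\<And>x. 0 \<le> h x"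
proof -
  \<comment> \<open>There are only countably many atoms, so \<open>cdf M - H\<close> is constant on a dense set, and hence
    everywhere by right continuity.\<close>
  define D where "D = {x. measure M {x} = 0}"
  have D: "countable (- D)"
    using countable_atoms by (simp add: D_def Collect_neg_eq[symmetric] zero_less_measure_iff)
  have dense: "\<exists>y\<in>D. x < y \<and> y < z" if "x < z" for x z
  proof -
    have "uncountable ({x<..<z} - (- D))"
      using that D by (intro uncountable_minus_countable) (simp_all add: uncountable_open_interval)
    then have "{x<..<z} - (- D) \<noteq> {}" by force
    then show ?thesis by auto
  qed
  obtain x0 where x0: "x0 \<in> D" using dense[of 0 1] by auto
  define K where "K x = cdf M x - H x" for x
  have const: "K y = K x0" if "y \<in> D" for y
  proof (cases y x0 rule: linorder_cases)
    case less
    then show ?thesis using eq[of y x0] that x0 cdf_diff_eq[of y x0] by (simp add: K_def D_def)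
  next
    case greater
    then show ?thesis using eq[of x0 y] that x0 cdf_diff_eq[of x0 y] by (simp add: K_def D_def)
  qed simp
  have K: "K x = K x0" for x
  proof (rule ccontr)
    assume ne: "K x \<noteq> K x0"
    have "(K \<longlongrightarrow> K x) (at_right x)"
      unfolding K_def
      by (intro tendsto_diff cdf_is_right_cont[unfolded continuous_within]
          DERIV_isCont[OF H, THEN isContD, THEN filterlim_mono, OF order_refl at_le]) auto
    then have "eventually (\<lambda>y. K y \<noteq> K x0) (at_right x)"
      using ne by (rule tendsto_imp_eventually_ne)
    then obtain z where "x < z" "\<And>y. x < y \<Longrightarrow> y < z \<Longrightarrow> K y \<noteq> K x0"
      unfolding eventually_at_right_field by blast
    then show False using dense[of x z] const by blast
  qed
  have cdf_diff: "cdf M y - cdf M x = H y - H x" for x y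
    using K[of x] K[of y] by (simp add: K_def)
  have mono: "mono_on UNIV H"
  proof (rule mono_onI)
    fix x y :: real assume "x \<le> y"
    then show "H x \<le> H y"
      using cdf_diff[of y x] cdf_nondecreasing[of x y] by simp
  qed
  show nonneg: "0 \<le> h x" for x
    by (rule mono_on_imp_deriv_nonneg[OF mono H]) simp
  have [measurable]: "h \<in> borel_measurable borel"
    using h by (rule borel_measurable_continuous_onI)
  \<comment> \<open>Half-open intervals form an intersection-stable generator, and on them the
    fundamental theorem of calculus gives equality.\<close>
  show "M = density lborel (\<lambda>x. ennreal (h x))"
  proof (rule measure_eqI_generator_eq)
    let ?E = "range (\<lambda>(a, b). {a<..b::real})"
    show "sets M = sigma_sets UNIV ?E" "sets (density lborel (\<lambda>x. ennreal (h x))) = sigma_sets UNIV ?E"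
      by (simp_all add: borel_sigma_sets_Ioc)
    show "Int_stable ?E"
      by (force simp: Int_stable_def)
    show "range (\<lambda>i::nat. {- real i<..real i}) \<subseteq> ?E" by auto
    show "(\<Union>i. {- real i<..real i}) = UNIV"
    proof (intro set_eqI iffI UNIV_I)
      fix x :: real
      obtain N where "\<bar>x\<bar> < real N" using reals_Archimedean2 by blast
      then show "x \<in> (\<Union>i. {- real i<..real i})" by (intro UN_I[of N]) auto
    qed
    fix A assume "A \<in> ?E"
    then obtain a b where A: "A = {a<..b}" by auto
    show "emeasure M A = emeasure (density lborel (\<lambda>x. ennreal (h x))) A"
    proof (cases "a < b")
      case True
      have "emeasure M A = ennreal (H b - H a)"
        using cdf_diff_eq[OF True] cdf_diff[of b a] by (simp add: A emeasure_eq_measure)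
      also have "\<dots> = (\<integral>\<^sup>+x. ennreal (h x) * indicator {a..b} x \<partial>lborel)"
        using True H nonneg by (intro nn_integral_FTC_Icc[symmetric]) auto
      also have "\<dots> = (\<integral>\<^sup>+x. ennreal (h x) * indicator A x \<partial>lborel)"
        using AE_lborel_singleton[of a]
        by (intro nn_integral_cong_AE) (auto simp: A split: split_indicator)
      finally show ?thesis by (simp add: emeasure_density A)
    qed (simp add: A)
  qed auto
qed

text \<open>This is the coefficient of \<open>x ^ n\<close> obtained by expanding
  \<open>exp (- \<i> * t * x)\<close> in the Fourier inversion integral. That integral is real by
  the conjugate symmetry of \<open>char M\<close>, so \<open>Re\<close> only changes the
  type.\<close>

definition density_coeff :: "nat \<Rightarrow> real"
  where "density_coeff n = Re (1 / (2 * pi) * (CLBINT t. (- \<i> * t) ^ n / fact n * char M t))"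

lemma Re_integral_density_coeff:
  "Re (1 / (2 * pi) * (CLBINT t. of_real y * ((- \<i> * t) ^ n / fact n * char M t))) = density_coeff n * y"
proof -
  have "Re (of_real v * (of_real y * z)) = Re (of_real v * z) * y" for v z
    by simp
  then show ?thesis
    by (simp only: density_coeff_def integral_mult_right_zero)
qed

section \<open>Entire densities from characteristic functions integrable against every
  exponential\<close>

context
  assumes int: "\<And>R. integrable lborel (\<lambda>t. exp (R * \<bar>t\<bar>) * norm (char M t))"
begin

text \<open>A single term of the series of \<open>exp \<bar>t\<bar>\<close> is at most the whole
  sum, so the weight with \<open>R = 1\<close> dominates.\<close>

lemma integrable_char_moment:
  "integrable lborel (\<lambda>t::real. (- \<i> * t) ^ n / fact n * char M t)"
proof (rule Bochner_Integration.integrable_bound[OF int[of 1]])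
  show "AE t in lborel. norm ((- \<i> * complex_of_real t) ^ n / fact n * char M t) \<le>
      norm (exp (1 * \<bar>t\<bar>) * norm (char M t))"
  proof (intro AE_I2)
    fix t :: real
    have "(\<Sum>i\<in>{n}. \<bar>t\<bar> ^ i / fact i) \<le> (\<Sum>i. \<bar>t\<bar> ^ i / fact i)"
      using exp_series_sums[of "\<bar>t\<bar>"] by (intro sum_le_suminf) (auto simp: sums_iff)
    then have "\<bar>t\<bar> ^ n / fact n \<le> exp \<bar>t\<bar>"
      using exp_series_sums[of "\<bar>t\<bar>"] by (simp add: sums_iff)
    from mult_right_mono[OF this norm_ge_zero[of "char M t"]]
    show "norm ((- \<i> * complex_of_real t) ^ n / fact n * char M t) \<le>
        norm (exp (1 * \<bar>t\<bar>) * norm (char M t))"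
      by (simp add: norm_mult norm_divide norm_power)
  qed
qed (use char_measurable in measurable)

text \<open>Before integration, the norms of the terms sum to
  \<open>exp (\<bar>x\<bar> * \<bar>t\<bar>) * norm (char M t)\<close>, which is integrable by the
  choice \<open>R = \<bar>x\<bar>\<close>. Thus the power series is entire.\<close>

lemma summable_norm_density_coeff: "summable (\<lambda>n. norm (density_coeff n * x ^ n))"
proof -
  let ?g = "\<lambda>n t::real. (- \<i> * t) ^ n / fact n * char M t"
  let ?f = "\<lambda>n t. of_real (x ^ n) * ?g n t"
  have sums: "(\<lambda>n. norm (?f n t)) sums (exp (\<bar>x\<bar> * \<bar>t\<bar>) * norm (char M t))" for t
    using sums_mult2[OF exp_series_sums[of "\<bar>x\<bar> * \<bar>t\<bar>"], of "norm (char M t)"]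
    by (simp add: norm_mult norm_power norm_divide power_mult_distrib mult_ac)
  have "summable (\<lambda>n. \<integral>t. norm (?f n t) \<partial>lborel)"
  proof (rule sums_integral_dominated(2)[OF _ int[of "\<bar>x\<bar>"]])
    show "integrable lborel (?f n)" for n
      by (intro integrable_mult_right integrable_char_moment)
    show "summable (\<lambda>n. norm (?f n t))" "(\<Sum>n. norm (?f n t)) \<le> exp (\<bar>x\<bar> * \<bar>t\<bar>) * norm (char M t)" for t
      using sums[of t] by (simp_all only: sums_iff order_refl)
  qed
  then have "summable (\<lambda>n. 1 / (2 * pi) * (\<integral>t. norm (?f n t) \<partial>lborel))"
    by (rule summable_mult)
  then show ?thesis
  proof (rule summable_comparison_test'[where N = 0])
    fix n
    have "density_coeff n * x ^ n = Re (1 / (2 * pi) * (CLBINT t. ?f n t))"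
      by (rule Re_integral_density_coeff[symmetric])
    then have "norm (density_coeff n * x ^ n) \<le> norm (1 / (2 * pi) * (CLBINT t. ?f n t))"
      using abs_Re_le_cmod by (simp only: real_norm_def)
    also have "\<dots> = 1 / (2 * pi) * norm (CLBINT t. ?f n t)"
      by (simp only: norm_mult[of "of_real (1 / (2 * pi))"] norm_of_real) simp
    also have "\<dots> \<le> 1 / (2 * pi) * (\<integral>t. norm (?f n t) \<partial>lborel)"
      by (intro mult_left_mono integral_norm_bound) simp
    finally show "norm (norm (density_coeff n * x ^ n)) \<le> 1 / (2 * pi) * (\<integral>t. norm (?f n t) \<partial>lborel)"
      by simp
  qed
qed

text \<open>The kernel of the inversion formula is expanded by
  \<open>iexp_diff_quotient_sums\<close> and integrated term by term.\<close>

lemma measure_Ioc_sums: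
  assumes ab: "a \<le> b" "measure M {a} = 0" "measure M {b} = 0"
  shows "(\<lambda>n. density_coeff n * ((b ^ Suc n - a ^ Suc n) / real (Suc n))) sums measure M {a<..b}"
proof -
  let ?g = "\<lambda>n t::real. (- \<i> * t) ^ n / fact n * char M t"
  let ?f = "\<lambda>n t. of_real ((b ^ Suc n - a ^ Suc n) / real (Suc n)) * ?g n t"
  let ?k = "\<lambda>t::real. (iexp (-(t * a)) - iexp (-(t * b))) / (\<i> * t) * char M t"
  \<comment> \<open>\<open>R\<close> bounds both end points, so the \<open>n\<close>-th coefficient
    is at most \<open>2 * R * R ^ n\<close> and the majorant is again an exponential series.\<close>
  define R where "R = max \<bar>a\<bar> \<bar>b\<bar>"
  define F where "F t = 2 * R * (exp (R * \<bar>t\<bar>) * norm (char M t))" for t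
  have coeff: "\<bar>(b ^ Suc n - a ^ Suc n) / real (Suc n)\<bar> \<le> 2 * R * R ^ n" for n
  proof -
    have "\<bar>b ^ Suc n - a ^ Suc n\<bar> \<le> \<bar>b\<bar> ^ Suc n + \<bar>a\<bar> ^ Suc n"
      using abs_triangle_ineq4[of "b ^ Suc n" "a ^ Suc n"] by (simp only: power_abs)
    also have "\<dots> \<le> R ^ Suc n + R ^ Suc n"
      by (intro add_mono power_mono) (auto simp: R_def)
    finally have "\<bar>b ^ Suc n - a ^ Suc n\<bar> \<le> 2 * R * R ^ n" by simp
    moreover have "0 \<le> 2 * R * R ^ n * real n" by (simp add: R_def)
    ultimately have "\<bar>b ^ Suc n - a ^ Suc n\<bar> \<le> 2 * R * R ^ n * real (Suc n)"
      by (simp only: of_nat_Suc distrib_left mult_1_right)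
    then show ?thesis
      unfolding abs_divide by (subst pos_divide_le_eq) auto
  qed
  have F_sums: "(\<lambda>n. 2 * R * R ^ n * norm (?g n t)) sums F t" for t
    using sums_mult[OF sums_mult2[OF exp_series_sums[of "R * \<bar>t\<bar>"], of "norm (char M t)"], of "2 * R"]
    by (simp add: F_def norm_mult norm_power norm_divide power_mult_distrib mult_ac)
  have f_le: "norm (?f n t) \<le> 2 * R * R ^ n * norm (?g n t)" for n t
    unfolding norm_mult[of "of_real _"] norm_of_real by (intro mult_right_mono coeff) auto
  have f_summable: "summable (\<lambda>n. norm (?f n t))" for t
    by (rule summable_comparison_test'[OF sums_summable[OF F_sums[of t]], of 0]) (use f_le in simp)
  have f_suminf: "(\<Sum>n. norm (?f n t)) \<le> F t" for t
    unfolding sums_unique[OF F_sums[of t]]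
    by (intro suminf_le f_le f_summable sums_summable[OF F_sums[of t]])
  have f_int: "integrable lborel (?f n)" for n
    by (intro integrable_mult_right integrable_char_moment)
  have F: "integrable lborel F"
    unfolding F_def by (intro integrable_mult_right int)
  note main = sums_integral_dominated[where f = ?f, OF f_int F f_summable f_suminf]
  \<comment> \<open>At \<open>t = 0\<close> division by zero makes the kernel \<open>0\<close>, whereas the series gives \<open>b - a\<close>.\<close>
  have AE: "AE t in lborel. (\<Sum>n. ?f n t) = ?k t"
    using AE_lborel_singleton[of 0]
  proof eventually_elim
    fix t :: real assume "t \<noteq> 0"
    from sums_mult2[OF iexp_diff_quotient_sums[OF this, of b a], of "char M t"]
    show "(\<Sum>n. ?f n t) = ?k t" by (simp only: sums_iff mult.assoc)
  qed
  have S_int: "integrable lborel (\<lambda>t. \<Sum>n. ?f n t)"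
    by (rule integrable_suminf[OF f_int _ main(2)]) (use f_summable in auto)
  have k_meas: "?k \<in> borel_measurable lborel"
    using char_measurable by measurable
  \<comment> \<open>Integrability of the kernel, required for inversion, is inherited from the
    series that equals it almost everywhere.\<close>
  have k_int: "integrable lborel ?k"
    by (rule integrable_cong_AE_imp[OF S_int k_meas]) (use AE in \<open>auto simp: eq_commute\<close>)
  have "(CLBINT t. (\<Sum>n. ?f n t)) = (CLBINT t. ?k t)"
    by (rule integral_cong_AE[OF borel_measurable_integrable[OF S_int] k_meas AE])
  with main(1) have "(\<lambda>n. CLBINT t. ?f n t) sums (CLBINT t. ?k t)"
    by simp
  then have "(\<lambda>n. Re (1 / (2 * pi) * (CLBINT t. ?f n t))) sums Re (1 / (2 * pi) * (CLBINT t. ?k t))"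
    by (intro sums_Re sums_mult)
  also have "1 / (2 * pi) * (CLBINT t. ?k t) = of_real (measure M {a<..b})"
    by (rule Levy_Inversion_integrable_char[OF ab k_int, symmetric])
  also have "(\<lambda>n. Re (1 / (2 * pi) * (CLBINT t. ?f n t))) =
      (\<lambda>n. density_coeff n * ((b ^ Suc n - a ^ Suc n) / real (Suc n)))"
    by (intro ext Re_integral_density_coeff)
  finally show ?thesis by simp
qed

text \<open>By \<open>measure_Ioc_sums\<close>, interval masses are increments of the termwise
  antiderivative of the series, so its derivative is the density.\<close>

lemma density_power_series:
  shows "M = density lborel (\<lambda>x. ennreal (\<Sum>n. density_coeff n * x ^ n))"
    and "\<And>x. 0 \<le> (\<Sum>n. density_coeff n * x ^ n)"
proof -
  \<comment> \<open>Coefficients of the antiderivative that vanishes at \<open>0\<close>.\<close>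
  define C where "C n = (case n of 0 \<Rightarrow> 0 | Suc m \<Rightarrow> density_coeff m / real (Suc m))" for n
  have C: "summable (\<lambda>n. C n * x ^ n)" for x
  proof (subst summable_Suc_iff[symmetric], rule summable_comparison_test'[where N = 0])
    show "summable (\<lambda>n. norm (density_coeff n * x ^ n) * \<bar>x\<bar>)"
      by (intro summable_mult2 summable_norm_density_coeff)
    fix n
    have "norm (C (Suc n) * x ^ Suc n) = norm (density_coeff n * x ^ n) * \<bar>x\<bar> / real (Suc n)"
      by (simp add: C_def abs_mult power_abs)
    also have "\<dots> \<le> norm (density_coeff n * x ^ n) * \<bar>x\<bar> / 1"
      by (intro divide_left_mono) auto
    also have "\<dots> = norm (density_coeff n * x ^ n) * \<bar>x\<bar>" by simp
    finally show "norm (C (Suc n) * x ^ Suc n) \<le> norm (density_coeff n * x ^ n) * \<bar>x\<bar>" .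
  qed
  have diffs: "diffs C = density_coeff"
    by (simp add: diffs_def C_def fun_eq_iff)
  let ?H = "\<lambda>x. \<Sum>n. C n * x ^ n" and ?h = "\<lambda>x. \<Sum>n. density_coeff n * x ^ n"
  have deriv: "(?H has_real_derivative ?h x) (at x)" for x
    using termdiffs_strong_converges_everywhere[OF C, of x] by (simp add: diffs)
  have cont: "continuous_on UNIV ?h"
    by (intro continuous_at_imp_continuous_on ballI isCont_powser_converges_everywhere
        summable_norm_cancel[OF summable_norm_density_coeff])
  have eq: "measure M {a<..b} = ?H b - ?H a"
    if "a \<le> b" "measure M {a} = 0" "measure M {b} = 0" for a b
  proof -
    have "(\<lambda>n. C n * b ^ n - C n * a ^ n) sums (?H b - ?H a)"
      by (intro sums_diff summable_sums C)
    then have "(\<lambda>n. C (Suc n) * b ^ Suc n - C (Suc n) * a ^ Suc n) sums (?H b - ?H a)"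
      by (subst sums_Suc_iff) (simp add: C_def)
    also have "(\<lambda>n. C (Suc n) * b ^ Suc n - C (Suc n) * a ^ Suc n) =
        (\<lambda>n. density_coeff n * ((b ^ Suc n - a ^ Suc n) / real (Suc n)))"
      by (simp add: C_def fun_eq_iff diff_divide_distrib right_diff_distrib)
    finally show ?thesis
      using measure_Ioc_sums[OF that] by (rule sums_unique2[rotated])
  qed
  show "M = density lborel (\<lambda>x. ennreal (?h x))"
    by (rule density_of_cdf_derivative(1)[OF eq deriv cont])
  show "0 \<le> ?h x" for x
    by (rule density_of_cdf_derivative(2)[OF eq deriv cont])
qed

end

end

section \<open>The density of a totally skewed stable law\<close>

text \<open>The line is cut at the null point \<open>0\<close> and the negative half is reflected,
  so that only half-line integrals remain, where the \<open>powr\<close> formulas apply.\<close>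

lemma
  fixes g :: "real \<Rightarrow> 'b :: {banach, second_countable_topology}"
  assumes pos: "set_integrable lborel {0<..} g"
    and neg: "set_integrable lborel {0<..} (\<lambda>x. g (- x))"
    and meas: "g \<in> borel_measurable borel"
  shows integrable_reflect_halves: "integrable lborel g"
    and integral_reflect_halves: "(\<integral>x. g x \<partial>lborel) = (LINT x:{0<..}|lborel. g x + g (- x))"
proof -
  let ?p = "\<lambda>x. indicator {0<..} x *\<^sub>R g x" and ?q = "\<lambda>x. indicator {0<..} x *\<^sub>R g (- x)"
  have p: "integrable lborel ?p" and q: "integrable lborel ?q"
    using pos neg by (simp_all add: set_integrable_def)
  have r: "integrable lborel (\<lambda>x. ?q (- x))" "(\<integral>x. ?q (- x) \<partial>lborel) = (\<integral>x. ?q x \<partial>lborel)"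
    using lborel_integrable_real_affine[OF q, of "- 1" 0]
      lborel_integral_real_affine[of "- 1" ?q 0] by simp_all
  have AE: "AE x in lborel. ?p x + ?q (- x) = g x"
    using AE_lborel_singleton[of 0] by eventually_elim (auto split: split_indicator)
  have sum: "integrable lborel (\<lambda>x. ?p x + ?q (- x))"
    by (rule Bochner_Integration.integrable_add[OF p r(1)])
  show "integrable lborel g"
    by (rule integrable_cong_AE_imp[OF sum]) (use meas AE in \<open>auto simp: eq_commute\<close>)
  have "(\<integral>x. g x \<partial>lborel) = (\<integral>x. ?p x + ?q (- x) \<partial>lborel)"
    by (rule integral_cong_AE) (use meas AE sum in \<open>auto simp: eq_commute\<close>)
  also have "\<dots> = (\<integral>x. ?p x \<partial>lborel) + (\<integral>x. ?q x \<partial>lborel)"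
    using p r by (subst Bochner_Integration.integral_add) auto
  also have "\<dots> = (LINT x:{0<..}|lborel. g x + g (- x))"
    unfolding set_lebesgue_integral_def scaleR_add_right
    by (rule Bochner_Integration.integral_add[OF p q, symmetric])
  finally show "(\<integral>x. g x \<partial>lborel) = (LINT x:{0<..}|lborel. g x + g (- x))" .
qed

text \<open>On a bounded interval \<open>g\<close> is bounded by some \<open>G\<close> and
  \<open>\<bar>x\<bar>\<close> by \<open>R\<close>, so the constant
  \<open>G * (\<Sum>n. norm (d n * R ^ n))\<close> dominates.\<close>

lemma integral_Icc_power_series_sums:
  fixes g :: "real \<Rightarrow> real" and d :: "nat \<Rightarrow> real"
  assumes d: "\<And>x. summable (\<lambda>n. norm (d n * x ^ n))" and g: "continuous_on {a..b} g"
  shows "(\<lambda>n. d n * (LINT x:{a..b}|lborel. g x * x ^ n)) sums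
    (LINT x:{a..b}|lborel. g x * (\<Sum>n. d n * x ^ n))"
proof -
  define R where "R = max \<bar>a\<bar> \<bar>b\<bar>"
  have "bounded (g ` {a..b})"
    by (intro compact_imp_bounded compact_continuous_image g) simp
  then obtain G where G: "\<And>x. x \<in> {a..b} \<Longrightarrow> \<bar>g x\<bar> \<le> G"
    unfolding bounded_iff real_norm_def by blast
  let ?f = "\<lambda>n x. indicator {a..b} x *\<^sub>R (d n * (g x * x ^ n))"
  let ?F = "\<lambda>x. indicator {a..b} x *\<^sub>R (G * (\<Sum>n. norm (d n * R ^ n)))"
  have f_int: "integrable lborel (?f n)" for n
  proof -
    have "continuous_on {a..b} (\<lambda>x. d n * (g x * x ^ n))"
      by (intro continuous_intros g)
    from borel_integrable_atLeastAtMost'[OF this] show ?thesis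
      by (simp only: set_integrable_def)
  qed
  have F_int: "integrable lborel ?F"
    using borel_integrable_atLeastAtMost'[of a b "\<lambda>x. G * (\<Sum>n. norm (d n * R ^ n))"]
    by (simp only: set_integrable_def continuous_on_const)
  have f_le: "norm (?f n x) \<le> indicator {a..b} x *\<^sub>R (G * norm (d n * R ^ n))" for n x
  proof (cases "x \<in> {a..b}")
    case True
    then have "\<bar>x\<bar> \<le> \<bar>R\<bar>" by (auto simp: R_def)
    then have "\<bar>g x\<bar> * \<bar>d n * x ^ n\<bar> \<le> G * \<bar>d n * R ^ n\<bar>"
      using G[OF True] by (intro mult_mono) (auto simp: abs_mult power_abs intro!: mult_left_mono power_mono)
    with True show ?thesis by (simp add: abs_mult mult_ac)
  qed simp
  have F_sums: "(\<lambda>n. indicator {a..b} x *\<^sub>R (G * norm (d n * R ^ n))) sums ?F x" for x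
    by (intro sums_scaleR_right sums_mult summable_sums d)
  have f_summable: "summable (\<lambda>n. norm (?f n x))" for x
    by (rule summable_comparison_test'[OF sums_summable[OF F_sums[of x]], of 0]) (use f_le in simp)
  have f_suminf: "(\<Sum>n. norm (?f n x)) \<le> ?F x" for x
    unfolding sums_unique[OF F_sums[of x]]
    by (intro suminf_le f_le f_summable sums_summable[OF F_sums[of x]])
  have "(\<Sum>n. ?f n x) = indicator {a..b} x *\<^sub>R (g x * (\<Sum>n. d n * x ^ n))" for x
  proof -
    have "(\<lambda>n. indicator {a..b} x *\<^sub>R (g x * (d n * x ^ n))) sums
        (indicator {a..b} x *\<^sub>R (g x * (\<Sum>n. d n * x ^ n)))"
      by (intro sums_scaleR_right sums_mult summable_sums summable_norm_cancel[OF d])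
    then show ?thesis by (simp only: sums_iff mult.left_commute)
  qed
  moreover have "(\<integral>x. ?f n x \<partial>lborel) = d n * (LINT x:{a..b}|lborel. g x * x ^ n)" for n
    unfolding set_lebesgue_integral_def by (simp add: mult.left_commute)
  ultimately show ?thesis
    using sums_integral_dominated(1)[where f = ?f and F = ?F, OF f_int F_int f_summable f_suminf]
    by (simp only: set_lebesgue_integral_def)
qed

text \<open>Euler's reflection formula, with \<open>rGamma\<close> on the right because
  \<open>1 - s\<close> may be a pole of \<open>Gamma\<close>; positivity keeps \<open>s\<close>
  itself away from the poles.\<close>

lemma Gamma_sin_eq_rGamma:
  fixes s :: real
  assumes "0 < s"
  shows "Gamma s * sin (pi * s) = pi * rGamma (1 - s)"
proof -
  have "complex_of_real (rGamma s * rGamma (1 - s)) = complex_of_real (sin (pi * s) / pi)"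
    using rGamma_reflection_complex[of "of_real s"]
    by (simp flip: rGamma_complex_of_real sin_of_real)
  then have *: "rGamma s * rGamma (1 - s) = sin (pi * s) / pi"
    by (simp only: of_real_eq_iff)
  have "s \<notin> \<int>\<^sub>\<le>\<^sub>0"
    using assms by (auto elim!: nonpos_Ints_cases)
  then have "Gamma s * rGamma s = 1"
    by (simp add: Gamma_def rGamma_eq_zero_iff)
  moreover have "Gamma s * sin (pi * s) = pi * ((Gamma s * rGamma s) * rGamma (1 - s))"
    using * by (simp add: field_simps)
  ultimately show ?thesis by simp
qed

text \<open>The law of the process at one fixed positive time \<open>t\<close>, with
  \<open>\<kappa>\<close> standing for \<open>t * \<sigma> powr \<alpha>\<close>.\<close>

locale stable_distribution = real_distribution M for M :: "real measure" +
  fixes \<alpha> \<kappa> :: real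
  assumes \<alpha>: "1 < \<alpha>" "\<alpha> \<le> 2" and \<kappa>: "0 < \<kappa>"
    and char_eq: "char M t = exp (- of_real (\<kappa> * \<bar>t\<bar> powr \<alpha>) *
        (1 + \<i> * of_real (tan (\<alpha> * pi / 2) * sgn t)))"
begin

text \<open>The norm of \<open>char M t\<close> is
  \<open>exp (- \<kappa> * \<bar>t\<bar> powr \<alpha>)\<close>. As \<open>\<alpha> > 1\<close>,
  half of this exponent absorbs \<open>R * \<bar>t\<bar>\<close> up to a constant and the other half
  keeps the function integrable.\<close>

lemma integrable_exp_char: "integrable lborel (\<lambda>t. exp (R * \<bar>t\<bar>) * norm (char M t))"
proof -
  let ?g = "\<lambda>t. exp (R * \<bar>t\<bar>) * norm (char M t)"
  have g: "?g t = exp (R * \<bar>t\<bar> - \<kappa> * \<bar>t\<bar> powr \<alpha>)" for t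
  proof -
    have "norm (char M t) = exp (- (\<kappa> * \<bar>t\<bar> powr \<alpha>))"
      unfolding char_eq norm_exp_eq_Re by simp
    then show ?thesis by (simp add: exp_add[symmetric])
  qed
  \<comment> \<open>\<open>B\<close> solves
    \<open>\<bar>R\<bar> * t = \<kappa> / 2 * t powr \<alpha>\<close>: beyond it the power term
    wins, and before it the linear term is at most \<open>\<bar>R\<bar> * B\<close>.\<close>
  define B where "B = (2 * \<bar>R\<bar> / \<kappa>) powr (1 / (\<alpha> - 1))"
  have bound: "R * t - \<kappa> * t powr \<alpha> \<le> \<bar>R\<bar> * B - \<kappa> / 2 * t powr \<alpha>" if "0 < t" for t
  proof (cases "t \<le> B")
    case True
    then have "R * t \<le> \<bar>R\<bar> * B"
      using that by (intro mult_mono) auto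
    moreover have "0 \<le> \<kappa> * t powr \<alpha>" using \<kappa> by simp
    ultimately show ?thesis by linarith
  next
    case False
    have "B powr (\<alpha> - 1) \<le> t powr (\<alpha> - 1)"
      using False \<alpha> by (intro powr_mono2) (auto simp: B_def)
    moreover have "B powr (\<alpha> - 1) = 2 * \<bar>R\<bar> / \<kappa>"
      using \<alpha> \<kappa> by (simp add: B_def powr_powr)
    ultimately have "\<bar>R\<bar> \<le> \<kappa> / 2 * t powr (\<alpha> - 1)"
      using \<kappa> by (simp add: field_simps)
    then have "\<bar>R\<bar> * t \<le> \<kappa> / 2 * t powr (\<alpha> - 1) * t"
      using that by (intro mult_right_mono) auto
    moreover have "t powr (\<alpha> - 1) * t = t powr \<alpha>"
      using that by (simp add: powr_diff)
    moreover have "R * t \<le> \<bar>R\<bar> * t" using that by (intro mult_right_mono) auto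
    moreover have "0 \<le> \<bar>R\<bar> * B" by (simp add: B_def)
    ultimately show ?thesis by (simp add: mult.assoc)
  qed
  have meas: "?g \<in> borel_measurable borel"
    using char_measurable by measurable
  \<comment> \<open>The factor \<open>t powr (1 - 1)\<close> makes this the case
    \<open>p = 1\<close> of the moment formula.\<close>
  have "set_integrable lborel {0<..} (\<lambda>t. exp (\<bar>R\<bar> * B) * (t powr (1 - 1) * exp (- (\<kappa> / 2) * t powr \<alpha>)))"
    using \<alpha> \<kappa> by (intro set_integrable_mult_right set_integral_powr_exp_powr(1)) auto
  then have pos: "set_integrable lborel {0<..} ?g"
    unfolding set_integrable_def
  proof (rule Bochner_Integration.integrable_bound)
    show "(\<lambda>t. indicator {0<..} t *\<^sub>R ?g t) \<in> borel_measurable lborel"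
      using meas by measurable
    show "AE t in lborel. norm (indicator {0<..} t *\<^sub>R ?g t) \<le>
        norm (indicator {0<..} t *\<^sub>R (exp (\<bar>R\<bar> * B) * (t powr (1 - 1) * exp (- (\<kappa> / 2) * t powr \<alpha>))))"
    proof (intro AE_I2)
      fix t :: real
      show "norm (indicator {0<..} t *\<^sub>R ?g t) \<le>
        norm (indicator {0<..} t *\<^sub>R (exp (\<bar>R\<bar> * B) * (t powr (1 - 1) * exp (- (\<kappa> / 2) * t powr \<alpha>))))"
      proof (cases "0 < t")
        case True
        from bound[OF this] have "exp (R * t - \<kappa> * t powr \<alpha>) \<le> exp (\<bar>R\<bar> * B + (- (\<kappa> / 2) * t powr \<alpha>))"
          by simp
        then have "exp (R * t - \<kappa> * t powr \<alpha>) \<le> exp (\<bar>R\<bar> * B) * exp (- (\<kappa> / 2) * t powr \<alpha>)"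
          by (simp only: exp_add)
        then show ?thesis
          unfolding g using True by simp
      qed simp
    qed
  qed
  have "?g (- t) = ?g t" for t
    using g[of t] g[of "- t"] by simp
  then have "set_integrable lborel {0<..} (\<lambda>t. ?g (- t))"
    using pos by presburger
  then show ?thesis
    by (rule integrable_reflect_halves[OF pos _ meas])
qed

lemmas stable_density = density_power_series[OF integrable_exp_char]
  and summable_norm_stable_coeff = summable_norm_density_coeff[OF integrable_exp_char]

lemma cos_neg: "cos (pi * \<alpha> / 2) < 0"
proof -
  have "pi * 1 < pi * \<alpha>" "pi * \<alpha> \<le> pi * 2"
    using \<alpha> by (intro mult_strict_left_mono mult_left_mono; simp)+
  then have "0 < cos (pi - pi * \<alpha> / 2)"
    using pi_gt_zero by (intro cos_gt_zero_pi) linarith+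
  then show ?thesis by simp
qed

lemma density_coeff_eq:
  "density_coeff n = (- 1) ^ n * (rGamma (1 - real (Suc n) / \<alpha>) *
    (- \<kappa> / cos (pi * \<alpha> / 2)) powr (- (real (Suc n) / \<alpha>)) / (\<alpha> * fact n))"
proof -
  \<comment> \<open>\<open>C\<close> and \<open>\<psi>\<close> are modulus and argument of
    \<open>w\<close>. The shift by \<open>pi\<close> in \<open>\<psi>\<close> compensates the
    negative sign of the cosine.\<close>
  define C where "C = - \<kappa> / cos (pi * \<alpha> / 2)"
  define \<psi> where "\<psi> = pi * \<alpha> / 2 - pi"
  define s where "s = real (Suc n) / \<alpha>"
  define w where "w = Complex \<kappa> (\<kappa> * tan (\<alpha> * pi / 2))"
  have C: "0 < C" using \<kappa> cos_neg by (simp add: C_def divide_pos_neg)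
  have s: "0 < s" using \<alpha> by (simp add: s_def)
  have w_exp: "w = exp (of_real (ln C) + \<i> * of_real \<psi>)"
  proof (rule complex_eqI)
    show "Re w = Re (exp (of_real (ln C) + \<i> * of_real \<psi>))"
      using C cos_neg by (simp add: w_def Re_exp \<psi>_def cos_diff) (simp add: C_def)
    show "Im w = Im (exp (of_real (ln C) + \<i> * of_real \<psi>))"
      using C cos_neg by (simp add: w_def Im_exp \<psi>_def sin_diff tan_def mult.commute) (simp add: C_def)
  qed
  have "pi * 1 < pi * \<alpha>" "pi * \<alpha> \<le> pi * 2"
    using \<alpha> by (intro mult_strict_left_mono mult_left_mono; simp)+
  \<comment> \<open>This range makes \<open>\<psi>\<close> the principal argument, which
    \<open>powr\<close> uses.\<close>
  then have "- pi < \<psi>" "\<psi> \<le> pi"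
    unfolding \<psi>_def using pi_gt_zero by linarith+
  then have "Ln w = of_real (ln C) + \<i> * of_real \<psi>"
    by (simp add: w_exp)
  then have w_powr: "w powr (- of_real s) = of_real (C powr (- s)) * cis (- (s * \<psi>))"
    using C by (simp add: powr_def w_exp cis_conv_exp exp_of_real[symmetric] exp_add[symmetric] algebra_simps)
  let ?g = "\<lambda>t::real. (- \<i> * t) ^ n / fact n * char M t"
  let ?h = "\<lambda>t. of_real (t powr (real (Suc n) - 1)) * exp (- w * of_real (t powr \<alpha>))"
  have g_pos: "?g t = (- \<i>) ^ n / fact n * ?h t" if "0 < t" for t
  proof -
    have "char M t = exp (- w * of_real (t powr \<alpha>))"
      using that by (simp add: char_eq w_def complex_eq_iff Re_exp Im_exp mult_ac)
    moreover have "(- \<i> * t) ^ n = (- \<i>) ^ n * of_real (t ^ n)"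
      unfolding of_real_power by (rule power_mult_distrib)
    moreover have "t powr (real (Suc n) - 1) = t ^ n"
      using that by (simp add: powr_realpow)
    ultimately show ?thesis
      by (simp only: times_divide_eq_left mult.assoc)
  qed
  \<comment> \<open>By this symmetry the negative half-line contributes the conjugate of
    \<open>J\<close>, so twice \<open>Re J\<close> remains.\<close>
  have g_neg: "?g (- t) = cnj (?g t)" for t
  proof -
    have "char M (- t) = cnj (char M t)"
      unfolding char_eq exp_cnj by (simp add: sgn_minus)
    then show ?thesis by simp
  qed
  have Rew: "0 < Re w" using \<kappa> by (simp add: w_def)
  note h = set_integral_powr_exp_complex_powr[of \<alpha> "real (Suc n)" w]
  have pos: "set_integrable lborel {0<..} ?g"
  proof -
    have "set_integrable lborel {0<..} (\<lambda>t. (- \<i>) ^ n / fact n * ?h t)"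
      using h(1) \<alpha> Rew by (intro set_integrable_mult_right) auto
    then show ?thesis
      by (rule set_integrable_cong[THEN iffD1, rotated -1]) (use g_pos in auto)
  qed
  have neg: "set_integrable lborel {0<..} (\<lambda>t. ?g (- t))"
    using integrable_bounded_linear[OF bounded_linear_cnj pos[unfolded set_integrable_def]]
    unfolding set_integrable_def g_neg complex_cnj_scaleR .
  define J where "J = (CLBINT t:{0<..}. ?g t)"
  have "(CLBINT t. ?g t) = (CLBINT t:{0<..}. ?g t + ?g (- t))"
    using char_measurable by (intro integral_reflect_halves pos neg) measurable
  also have "\<dots> = J + cnj J"
  proof -
    have "(CLBINT t:{0<..}. ?g (- t)) = cnj J"
      unfolding g_neg J_def set_lebesgue_integral_def complex_cnj_scaleR[symmetric]
      by (rule Bochner_Integration.integral_cnj)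
    then show ?thesis
      using set_integral_add(2)[OF pos neg] by (simp add: J_def)
  qed
  finally have "density_coeff n = Re J / pi"
    unfolding density_coeff_def by (simp add: complex_add_cnj)
  also have "J = (- \<i>) ^ n / fact n * (of_real (Gamma s / \<alpha>) * w powr (- of_real s))"
  proof -
    have "J = (CLBINT t:{0<..}. (- \<i>) ^ n / fact n * ?h t)"
      unfolding J_def by (intro set_lebesgue_integral_cong) (use g_pos in auto)
    also have "\<dots> = (- \<i>) ^ n / fact n * (CLBINT t:{0<..}. ?h t)"
      by (rule set_integral_mult_right)
    finally show ?thesis
      using h(2) \<alpha> Rew by (simp add: s_def)
  qed
  also have "\<dots> = of_real (Gamma s * C powr (- s) / (\<alpha> * fact n)) * cis (- (real n * (pi / 2) + s * \<psi>))"
  proof -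
    have "- \<i> = cis (- (pi / 2))" by (simp add: complex_eq_iff)
    then have "(- \<i>) ^ n = cis (- (real n * (pi / 2)))" by (simp only: Complex.DeMoivre mult_minus_right)
    moreover have "cis (- (x + y)) = cis (- x) * cis (- y)" for x y
      by (simp add: cis_mult)
    ultimately show ?thesis
      unfolding w_powr by (simp add: mult_ac)
  qed
  \<comment> \<open>Because \<open>s * \<alpha> = n + 1\<close>, the phases from the power of
    \<open>- \<i>\<close> and from \<open>w\<close> combine so that the cosine becomes a signed
    \<open>sin (pi * s)\<close>, ready for reflection.\<close>
  also have "real n * (pi / 2) + s * \<psi> = real n * pi + (pi / 2 - pi * s)"
    using \<alpha> by (simp add: s_def \<psi>_def field_simps)
  also have "Re (of_real (Gamma s * C powr (- s) / (\<alpha> * fact n)) * cis (- (real n * pi + (pi / 2 - pi * s)))) =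
      Gamma s * C powr (- s) / (\<alpha> * fact n) * ((- 1) ^ n * sin (pi * s))"
  proof -
    have "cos (real n * pi + (pi / 2 - pi * s)) = (- 1) ^ n * sin (pi * s)"
      by (simp add: cos_add cos_diff)
    then show ?thesis
      by (simp only: times_complex.sel Re_complex_of_real Im_complex_of_real cis.sel cos_minus
          mult_zero_left diff_zero)
  qed
  also have "\<dots> / pi = (- 1) ^ n * (rGamma (1 - s) * C powr (- s) / (\<alpha> * fact n))"
  proof -
    have "Gamma s * C powr (- s) / (\<alpha> * fact n) * ((- 1) ^ n * sin (pi * s)) / pi =
        (- 1) ^ n * ((Gamma s * sin (pi * s)) * C powr (- s) / (\<alpha> * fact n)) / pi"
      by (simp add: mult_ac)
    also have "\<dots> = (- 1) ^ n * (rGamma (1 - s) * C powr (- s) / (\<alpha> * fact n))"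
      unfolding Gamma_sin_eq_rGamma[OF s] by simp
    finally show ?thesis .
  qed
  finally show ?thesis by (simp add: C_def s_def)
qed

end

section \<open>The value of the option\<close>

lemma set_integral_power_Icc:
  fixes a b :: real
  assumes "a \<le> b"
  shows "(LINT x:{a..b}|lborel. x ^ k) = (b ^ Suc k - a ^ Suc k) / real (Suc k)"
  using integral_power[OF assms, of k]
  by (simp add: set_lebesgue_integral_def mult.commute diff_divide_distrib)

text \<open>Expanding the exponential leaves integrals of the monomials \<open>x ^ (n + m)\<close>;
  this produces the inner sum over \<open>m\<close>.\<close>

lemma set_integral_power_exp_Icc_sums:
  fixes a b u :: real
  assumes "a \<le> b"
  shows "(\<lambda>m. (- u) ^ m * (b ^ (1 + n + m) - a ^ (1 + n + m)) / (real (1 + n + m) * fact m)) sums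
    (LINT x:{a..b}|lborel. exp (- (u * x)) * x ^ n)"
proof -
  let ?d = "\<lambda>m. (- u) ^ m / fact m"
  have sums: "(\<lambda>m. ?d m * x ^ m) sums exp (- (u * x))" for x
    using exp_series_sums[of "- u * x"] unfolding power_mult_distrib by simp
  have abs: "summable (\<lambda>m. norm (?d m * x ^ m))" for x
    using sums_summable[OF exp_series_sums[of "\<bar>u * x\<bar>"]]
    by (simp add: abs_mult power_abs power_mult_distrib)
  have eq: "(\<Sum>m. ?d m * x ^ m) = exp (- (u * x))" for x
    using sums[of x] by (simp only: sums_iff)
  have "(\<lambda>m. ?d m * (LINT x:{a..b}|lborel. x ^ n * x ^ m)) sums
      (LINT x:{a..b}|lborel. x ^ n * (\<Sum>m. ?d m * x ^ m))"
    by (intro integral_Icc_power_series_sums abs continuous_intros)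
  also have "(\<lambda>m. ?d m * (LINT x:{a..b}|lborel. x ^ n * x ^ m)) =
      (\<lambda>m. (- u) ^ m * (b ^ (1 + n + m) - a ^ (1 + n + m)) / (real (1 + n + m) * fact m))"
    unfolding power_add[symmetric] set_integral_power_Icc[OF assms] by (simp add: fun_eq_iff mult.commute)
  finally show ?thesis
    by (simp only: eq mult.commute[of "_ ^ n"])
qed

text \<open>\<open>rGamma\<close> realizes the convention that the reciprocal of
  \<open>Gamma\<close> vanishes at its poles. Convergence of the inner and outer series is claimed
  explicitly, since an infinite sum in HOL has a value even when it diverges.\<close>

theorem proposition6:
  fixes M :: "'a measure" and X :: "real \<Rightarrow> 'a \<Rightarrow> real"
    and \<alpha> \<sigma> u S Km Kp r \<tau> \<mu> km kp :: real
    and a :: "nat \<Rightarrow> nat \<Rightarrow> real"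
  assumes "1 < \<alpha>" "\<alpha> \<le> 2" "0 < \<sigma>" "0 < u" "0 < S" "0 < Km" "Km < Kp" "0 < \<tau>"
    and "spectrally_negative_stable_process M X \<alpha> \<sigma>"
    and "\<mu> = \<sigma> powr \<alpha> / cos (pi * \<alpha> / 2)"
    and "kp = ln (S / Kp powr (1 / u)) + r * \<tau>"
    and "km = ln (S / Km powr (1 / u)) + r * \<tau>"
    and "\<And>n m. a n m =
      (- u) ^ m * ((km + \<mu> * \<tau>) ^ (1 + n + m) - (kp + \<mu> * \<tau>) ^ (1 + n + m)) /
        (real (1 + n + m) * fact n * fact m) *
      rGamma (1 - real (1 + n) / \<alpha>) * (- \<mu> * \<tau>) powr (- (real (1 + n) / \<alpha>))"
  shows "(\<forall>n. summable (\<lambda>m. a n m)) \<and> summable (\<lambda>n. \<Sum>m. a n m) \<and>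
    option_value M X (capped_power_asset_or_nothing_call u) S Kp Km r \<mu> \<tau> =
      exp (- r * \<tau>) / \<alpha> * S powr u * exp (u * (r + \<mu>) * \<tau>) * (\<Sum>n. \<Sum>m. a n m)"
proof -
  note \<alpha> = assms(1,2) and \<sigma> = assms(3) and u = assms(4) and S = assms(5)
    and K = assms(6,7) and \<tau> = assms(8) and X = assms(9) and \<mu> = assms(10)
    and kp = assms(11) and km = assms(12) and a = assms(13)
  interpret X: spectrally_negative_stable_process M X \<alpha> \<sigma> by (rule X)
  define \<kappa> where "\<kappa> = \<tau> * \<sigma> powr \<alpha>"
  define N where "N = distr M borel (X \<tau>)"
  have X_meas [measurable]: "X \<tau> \<in> borel_measurable M"
    using X.random_variable_X \<tau> by simp
  have N: "real_distribution N"
    unfolding N_def by (rule X.real_distribution_distr) simp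
  interpret N: stable_distribution N \<alpha> \<kappa>
  proof (intro stable_distribution.intro N stable_distribution_axioms.intro \<alpha>)
    show "0 < \<kappa>" using \<tau> \<sigma> by (simp add: \<kappa>_def)
    show "char N t = exp (- of_real (\<kappa> * \<bar>t\<bar> powr \<alpha>) *
        (1 + \<i> * of_real (tan (\<alpha> * pi / 2) * sgn t)))" for t
      using X.char_X[of \<tau> t] \<tau> by (simp add: N_def \<kappa>_def)
  qed
  \<comment> \<open>The option pays exactly when \<open>X \<tau>\<close> lies in
    \<open>(- B, - A)\<close>, so \<open>A\<close> and \<open>B\<close> bound the range of the
    reflected variable. The \<open>d n\<close> below are the density coefficients after
    reflection.\<close>
  define A B where "A = kp + \<mu> * \<tau>" and "B = km + \<mu> * \<tau>"
  define L where "L = (r + \<mu>) * \<tau>"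
  define c where "c = N.density_coeff"
  define d where "d n = (- 1) ^ n * c n" for n
  let ?h = "\<lambda>x. \<Sum>n. c n * x ^ n"
  have A: "A = ln S - ln Kp / u + L" and B: "B = ln S - ln Km / u + L"
    using S K by (simp_all add: A_def B_def kp km L_def ln_div ln_powr algebra_simps)
  have AB: "A \<le> B"
    using K u by (simp add: A B divide_right_mono)
  \<comment> \<open>The reflection cancels the alternating sign, and the scale
    \<open>- \<kappa> / cos (pi * \<alpha> / 2)\<close> is \<open>- \<mu> * \<tau>\<close>. What
    remains is the part of \<open>a n m\<close> independent of \<open>m\<close>.\<close>
  have d_eq: "\<alpha> * d n = rGamma (1 - real (1 + n) / \<alpha>) * (- \<mu> * \<tau>) powr (- (real (1 + n) / \<alpha>)) / fact n" for n
  proof -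
    have "- \<kappa> / cos (pi * \<alpha> / 2) = - \<mu> * \<tau>"
      by (simp add: \<kappa>_def \<mu>)
    then show ?thesis
      using \<alpha> by (simp add: d_def c_def N.density_coeff_eq flip: power_mult_distrib)
  qed
  have h_neg: "?h (- x) = (\<Sum>n. d n * x ^ n)" for x
    by (simp add: d_def power_minus[of x] mult_ac)
  have d_abs: "summable (\<lambda>n. norm (d n * x ^ n))" for x
    using N.summable_norm_stable_coeff[of x] by (simp add: d_def c_def abs_mult power_abs)
  have a_sums: "(\<lambda>m. a n m) sums (\<alpha> * (d n * (LINT x:{A..B}|lborel. exp (- (u * x)) * x ^ n)))" for n
  proof -
    have "(\<lambda>m. \<alpha> * d n * ((- u) ^ m * (B ^ (1 + n + m) - A ^ (1 + n + m)) / (real (1 + n + m) * fact m))) sums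
        (\<alpha> * d n * (LINT x:{A..B}|lborel. exp (- (u * x)) * x ^ n))"
      by (intro sums_mult set_integral_power_exp_Icc_sums AB)
    then show ?thesis
      unfolding d_eq a A_def[symmetric] B_def[symmetric] mult.assoc[symmetric]
      by (simp only: times_divide_eq_left times_divide_eq_right divide_divide_eq_left mult_ac)
  qed
  \<comment> \<open>The inner sums are already integrals over \<open>{A..B}\<close>; summing over
    \<open>n\<close> reassembles the reflected density under the integral.\<close>
  have sum_a: "(\<lambda>n. \<Sum>m. a n m) sums (\<alpha> * (LINT x:{A..B}|lborel. exp (- (u * x)) * ?h (- x)))"
    unfolding h_neg sums_unique[OF a_sums, symmetric]
    by (intro sums_mult integral_Icc_power_series_sums d_abs continuous_intros)
  have payoff: "capped_power_asset_or_nothing_call u (S * exp (L + x)) Kp Km =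
      S powr u * exp (u * L) * (indicator {- B<..<- A} x * exp (u * x))" for x
  proof -
    \<comment> \<open>In this form the logarithm makes both strike conditions linear in
      \<open>x\<close>.\<close>
    have *: "(S * exp (L + x)) powr u = exp (u * (ln S + L + x))"
      using S by (simp add: powr_def ln_mult)
    have "Km < exp (u * (ln S + L + x)) \<longleftrightarrow> - B < x"
    proof -
      have "Km < exp (u * (ln S + L + x)) \<longleftrightarrow> ln Km < u * (ln S + L + x)"
        using K ln_less_cancel_iff[of Km "exp (u * (ln S + L + x))"] by simp
      also have "\<dots> \<longleftrightarrow> - B < x"
        using u by (simp add: B field_simps)
      finally show ?thesis .
    qed
    moreover have "exp (u * (ln S + L + x)) < Kp \<longleftrightarrow> x < - A"
    proof -
      have "exp (u * (ln S + L + x)) < Kp \<longleftrightarrow> u * (ln S + L + x) < ln Kp"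
        using K ln_less_cancel_iff[of "exp (u * (ln S + L + x))" Kp] by simp
      also have "\<dots> \<longleftrightarrow> x < - A"
        using u by (simp add: A field_simps)
      finally show ?thesis .
    qed
    moreover have "exp (u * (ln S + L + x)) = S powr u * exp (u * L) * exp (u * x)"
      using S by (simp add: powr_def exp_add[symmetric] algebra_simps)
    ultimately show ?thesis
      unfolding capped_power_asset_or_nothing_call_def * by (simp add: indicator_def)
  qed
  have h_meas [measurable]: "?h \<in> borel_measurable borel"
    by measurable
  have h_nonneg: "0 \<le> ?h x" for x
    unfolding c_def by (rule N.stable_density(2))
  have N_eq: "N = density lborel (\<lambda>x. ennreal (?h x))"
    unfolding c_def by (rule N.stable_density(1))
  have "(\<integral>\<omega>. capped_power_asset_or_nothing_call u (asset_price X S r \<mu> \<tau> \<omega>) Kp Km \<partial>M) =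
      (\<integral>\<omega>. S powr u * exp (u * L) * (indicator {- B<..<- A} (X \<tau> \<omega>) * exp (u * X \<tau> \<omega>)) \<partial>M)"
    unfolding asset_price_def L_def[symmetric] payoff ..
  also have "\<dots> = S powr u * exp (u * L) * (\<integral>x. indicator {- B<..<- A} x * exp (u * x) \<partial>N)"
    unfolding N_def by (subst integral_distr) auto
  also have "(\<integral>x. indicator {- B<..<- A} x * exp (u * x) \<partial>N) =
      (\<integral>x. ?h x * (indicator {- B<..<- A} x * exp (u * x)) \<partial>lborel)"
    unfolding N_eq by (subst integral_real_density) (use h_nonneg in auto)
  \<comment> \<open>Reflection moves the interval to \<open>(A, B)\<close> and gives the weight
    \<open>exp (- (u * x))\<close>.\<close>
  also have "\<dots> = (\<integral>x. ?h (- x) * (indicator {- B<..<- A} (- x) * exp (- (u * x))) \<partial>lborel)"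
    using lborel_integral_real_affine[of "- 1" "\<lambda>x. ?h x * (indicator {- B<..<- A} x * exp (u * x))" 0]
    by simp
  also have "\<dots> = (LINT x:{A..B}|lborel. exp (- (u * x)) * ?h (- x))"
    unfolding set_lebesgue_integral_def
  proof (rule integral_cong_AE)
    show "AE x in lborel. ?h (- x) * (indicator {- B<..<- A} (- x) * exp (- (u * x))) =
        indicator {A..B} x *\<^sub>R (exp (- (u * x)) * ?h (- x))"
      \<comment> \<open>Open and closed interval differ only in the null points \<open>A\<close> and
        \<open>B\<close>.\<close>
      using AE_lborel_singleton[of A] AE_lborel_singleton[of B]
      by eventually_elim (auto simp: indicator_def)
  qed measurable
  \<comment> \<open>The factor \<open>\<alpha>\<close> is inserted against the prefactor
    \<open>1 / \<alpha>\<close> to match the value of the double series in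
    \<open>sum_a\<close>.\<close>
  finally have "option_value M X (capped_power_asset_or_nothing_call u) S Kp Km r \<mu> \<tau> =
      exp (- r * \<tau>) / \<alpha> * S powr u * exp (u * (r + \<mu>) * \<tau>) *
        (\<alpha> * (LINT x:{A..B}|lborel. exp (- (u * x)) * ?h (- x)))"
    using \<alpha> by (simp add: option_value_def L_def mult_ac)
  then show ?thesis
    using a_sums sum_a by (auto simp: sums_iff)
qed

end
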